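(* Let $X$ be the subordinate Brownian motion in $\mathbb R^d$, $d\ge1$, associated with a subordinator whose Laplace exponent $\phi$ is a complete Bernstein function with zero killing coefficient such that, for some $\alpha\in(0,2)$ and some measurable $\ell:(0,\infty)\to(0,\infty)$ that is locally bounded above and below by positive constants and slowly varying at infinity, $\phi(\lambda)\asymp\lambda^{\alpha/2}\ell(\lambda)$ as $\lambda\to\infty$. Then the Lévy density $J$ of $X$ satisfies $$J(x)\asymp\frac{\phi(|x|^{-2})}{|x|^{d}}\asymp\frac{\ell(|x|^{-2})}{|x|^{d+\alpha}},\qquad|x|\to0.$$
   Context: A Bernstein function is $\phi(\lambda)=a+b\lambda+\int_{(0,\infty)}(1-e^{-\lambda t})\,\mu(dt)$ on $(0,\infty)$ with $a,b\ge0$ and $\int(1\wedge t)\,\mu(dt)<\infty$; $a$ is the killing coefficient. It is a complete Bernstein function if $\mu$ has a completely monotone density, denoted $\mu(t)$. A subordinator $S=(S_t)_{t\ge0}$ is an increasing Lévy process with $S_0=0$; its Laplace exponent is given by $\mathbb E[e^{-\lambda S_t}]=e^{-t\phi(\lambda)}$. Let $B$ be a Brownian motion in $\mathbb R^d$ with transition density $p(t,x)=(4\pi t)^{-d/2}e^{-|x|^2/(4t)}$, independent of $S$. The subordinate Brownian motion is $X_t=B_{S_t}$, a Lévy process with characteristic exponent $\phi(|\xi|^2)$. Its Lévy measure has density $J(x)=\int_0^\infty p(t,x)\mu(t)\,dt$, called the Lévy density of $X$. $\ell$ is slowly varying at infinity if $\lim_{t\to\infty}\ell(\lambda t)/\ell(t)=1$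 for every $\lambda>0$. Convention: $f\asymp g$ as $\lambda\to\infty$ (resp. as $|x|\to0$) means there is a constant $c>1$ with $c^{-1}\le f/g\le c$ for all $\lambda\ge1$ (resp. all $0<|x|\le1$). *)

theory Defs
  imports "HOL-Probability.Probability"
begin

text \<open>Two-sided comparability \<open>f \<asymp> g\<close>, with one constant valid on the whole set \<open>A\<close>.
  Since \<open>f x / 0 = 0\<close>, the lower bound forces \<open>g x \<noteq> 0\<close> on \<open>A\<close>.\<close>

definition comparable_on :: "'b set \<Rightarrow> ('b \<Rightarrow> real) \<Rightarrow> ('b \<Rightarrow> real) \<Rightarrow> bool" where
  "comparable_on A f g \<longleftrightarrow> (\<exists>c>1. \<forall>x\<in>A. inverse c \<le> f x / g x \<and> f x / g x \<le> c)"

definition slowly_varying :: "(real \<Rightarrow> real) \<Rightarrow> bool" where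
  "slowly_varying l \<longleftrightarrow> (\<forall>c>0. ((\<lambda>t. l (c * t) / l t) \<longlongrightarrow> 1) at_top)"

definition locally_bounded_above_below :: "(real \<Rightarrow> real) \<Rightarrow> bool" where
  "locally_bounded_above_below l \<longleftrightarrow>
     (\<forall>K. compact K \<and> K \<subseteq> {0<..} \<longrightarrow> (\<exists>c>0. \<exists>C>0. \<forall>t\<in>K. c \<le> l t \<and> l t \<le> C))"

definition completely_monotone :: "(real \<Rightarrow> real) \<Rightarrow> bool" where
  "completely_monotone f \<longleftrightarrow>
     (\<forall>n. \<forall>t>0. (deriv ^^ n) f field_differentiable at t \<and> 0 \<le> (-1) ^ n * (deriv ^^ n) f t)"

definition bernstein_rep :: "(real \<Rightarrow> real) \<Rightarrow> real \<Rightarrow> real \<Rightarrow> real measure \<Rightarrow> bool" where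
  "bernstein_rep \<phi> a b \<mu> \<longleftrightarrow>
     0 \<le> a \<and> 0 \<le> b \<and> sets \<mu> = sets borel \<and> emeasure \<mu> {..0} = 0 \<and>
     (\<integral>\<^sup>+t. ennreal (min 1 t) \<partial>\<mu>) < \<infinity> \<and>
     (\<forall>r>0. \<phi> r = a + b * r + (\<integral>t. (1 - exp (- r * t)) \<partial>\<mu>))"

text \<open>The function \<open>m\<close> is the completely monotone density of the measure in the representation;
  its values outside \<open>(0,\<infinity>)\<close> are irrelevant.\<close>

definition complete_bernstein_rep :: "(real \<Rightarrow> real) \<Rightarrow> real \<Rightarrow> real \<Rightarrow> (real \<Rightarrow> real) \<Rightarrow> bool" where
  "complete_bernstein_rep \<phi> a b m \<longleftrightarrow>
     completely_monotone m \<and>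
     bernstein_rep \<phi> a b (density lborel (\<lambda>t. ennreal (indicator {0<..} t * m t)))"

text \<open>Processes are indexed by \<open>real\<close>, but only their values at times \<open>t \<ge> 0\<close> are constrained.\<close>

definition levy_process ::
  "'w measure \<Rightarrow> (real \<Rightarrow> 'w \<Rightarrow> 'a::euclidean_space) \<Rightarrow> bool" where
  "levy_process M X \<longleftrightarrow>
     prob_space M \<and>
     (\<forall>t\<ge>0. X t \<in> borel_measurable M) \<and>
     (AE w in M. X 0 w = 0) \<and>
     (\<forall>(s::nat \<Rightarrow> real) n. 0 \<le> s 0 \<and> mono s \<longrightarrow>
        prob_space.indep_vars M (\<lambda>_. borel) (\<lambda>i w. X (s (Suc i)) w - X (s i) w) {..<n}) \<and>
     (\<forall>s\<ge>0. \<forall>t\<ge>0. distr M borel (\<lambda>w. X (s + t) w - X s w) = distr M borel (X t)) \<and>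
     (AE w in M. (\<forall>t\<ge>0. ((\<lambda>s. X s w) \<longlongrightarrow> X t w) (at_right t)) \<and>
                 (\<forall>t>0. \<exists>y. ((\<lambda>s. X s w) \<longlongrightarrow> y) (at_left t)))"

definition subordinator :: "'w measure \<Rightarrow> (real \<Rightarrow> 'w \<Rightarrow> real) \<Rightarrow> bool" where
  "subordinator M S \<longleftrightarrow> levy_process M S \<and> (AE w in M. mono_on {0..} (\<lambda>t. S t w))"

definition laplace_exponent ::
  "'w measure \<Rightarrow> (real \<Rightarrow> 'w \<Rightarrow> real) \<Rightarrow> (real \<Rightarrow> real) \<Rightarrow> bool" where
  "laplace_exponent M S \<phi> \<longleftrightarrow>
     (\<forall>t\<ge>0. \<forall>r>0. (\<integral>w. exp (- r * S t w) \<partial>M) = exp (- t * \<phi> r))"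

definition heat_kernel :: "real \<Rightarrow> 'a::euclidean_space \<Rightarrow> real" where
  "heat_kernel t x = (4 * pi * t) powr (- (real DIM('a) / 2)) * exp (- (norm x)\<^sup>2 / (4 * t))"

text \<open>The generator is the Laplacian, i.e. each coordinate has variance \<open>2 t\<close> at time \<open>t\<close>.\<close>

definition brownian_motion ::
  "'w measure \<Rightarrow> (real \<Rightarrow> 'w \<Rightarrow> 'a::euclidean_space) \<Rightarrow> bool" where
  "brownian_motion M B \<longleftrightarrow>
     levy_process M B \<and>
     (\<forall>t>0. distributed M lborel (B t) (\<lambda>x. ennreal (heat_kernel t x))) \<and>
     (AE w in M. continuous_on {0..} (\<lambda>t. B t w))"

definition process_events ::
  "'w measure \<Rightarrow> (real \<Rightarrow> 'w \<Rightarrow> 'a::euclidean_space) \<Rightarrow> 'w set set" where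
  "process_events M X =
     sigma_sets (space M) {X t -` A \<inter> space M | t A. 0 \<le> t \<and> A \<in> sets borel}"

definition subordinate_brownian_motion ::
  "'w measure \<Rightarrow> (real \<Rightarrow> 'w \<Rightarrow> 'a::euclidean_space) \<Rightarrow> (real \<Rightarrow> 'w \<Rightarrow> real) \<Rightarrow>
   (real \<Rightarrow> 'w \<Rightarrow> 'a) \<Rightarrow> bool" where
  "subordinate_brownian_motion M B S X \<longleftrightarrow>
     brownian_motion M B \<and> subordinator M S \<and>
     prob_space.indep_set M (process_events M B) (process_events M S) \<and>
     (\<forall>t\<ge>0. \<forall>w\<in>space M. X t w = B (S t w) w)"

text \<open>The integrand is integrable for \<open>x \<noteq> 0\<close> whenever \<open>min 1 t * m t\<close> is; the value at
  \<open>x = 0\<close> is never used.\<close>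

definition sbm_levy_density :: "(real \<Rightarrow> real) \<Rightarrow> 'a::euclidean_space \<Rightarrow> real" where
  "sbm_levy_density m x = (LINT t:{0<..}|lborel. heat_kernel t x * m t)"

end

theory Submission
  imports Defs
begin

text \<open>
  Write \<open>\<mu>\<close> for the measure with density \<open>m\<close> on the half line and \<open>p\<close> for the Gaussian kernel, and
  put \<open>R = |x|\<^sup>-\<^sup>2\<close>.
  Everything is read off from the fact that \<open>1 - exp (- u)\<close> and \<open>min 1 u\<close> agree up to a factor 2 for \<open>u \<ge> 0\<close>,
  so that \<open>\<phi> r\<close> is comparable to \<open>a + b r + \<integral> min 1 (r t) \<mu>(dt)\<close>
  (\<open>bernstein_rep_le_truncated\<close>, \<open>truncated_le_bernstein_rep\<close>).

  The upper bound for \<open>J\<close> comes from the scaling and the exponential decay of the kernel, which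
  give \<open>p(t,x) \<le> C |x|\<^sup>-\<^sup>d min 1 (R t)\<close>
  (\<open>heat_kernel_le_truncated\<close>), and so, by integration against \<open>\<mu>\<close>,
  \<open>J(x) \<le> 2 C |x|\<^sup>-\<^sup>d \<phi>(R)\<close>.

  For the lower bound the point is that \<open>m(s) \<ge> k \<phi>(1/s) / s\<close> for small \<open>s\<close>
  (\<open>complete_bernstein_density_lower\<close>).  Splitting the half line at \<open>\<delta>/r\<close> and
  \<open>A/r\<close> yields
  \<open>\<phi>(r) \<le> 2 \<delta> \<phi>(r/\<delta>) + 2 \<phi>(r/A) + \<mu>[\<delta>/r, A/r]\<close>.  Regular variation with index
  \<open>\<beta> = \<alpha>/2\<close> bounds the first two terms by constant multiples of
  \<open>\<delta> powr (1 - \<beta>) * \<phi>(r)\<close> and \<open>A powr (- \<beta>) * \<phi>(r)\<close> for large \<open>r\<close>.  As \<open>0 < \<beta> < 1\<close>, both are at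
  most \<open>\<phi>(r)/4\<close> once \<open>\<delta>\<close> is small and \<open>A\<close> is large, so the window \<open>[\<delta>/r, A/r]\<close> carries at
  least half of \<open>\<phi>(r)\<close>; since \<open>m\<close> decreases, this is a lower bound for \<open>m(\<delta>/r)\<close>.  Finally
  \<open>J(x)\<close> is at least the contribution of \<open>t \<in> [s/2, s]\<close> with \<open>s = t\<^sub>1 |x|\<^sup>2\<close>, where the kernel
  is of order \<open>|x|\<^sup>-\<^sup>d\<close>.  The choice of \<open>s\<close> proportional to \<open>|x|\<^sup>2\<close> keeps \<open>s \<le> t\<^sub>1\<close> for all
  \<open>|x| \<le> 1\<close> at once, so that one constant serves up to the boundary of the unit ball.
\<close>

section \<open>Bernstein functions and truncated integrals\<close>

lemma half_min_le_one_minus_exp: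
  fixes u :: real
  assumes "0 \<le> u"
  shows "min 1 u / 2 \<le> 1 - exp (- u)"
proof -
  have "1 + u \<le> exp u" by (rule exp_ge_add_one_self)
  then have "exp (- u) \<le> 1 / (1 + u)"
    using assms by (simp add: exp_minus field_simps)
  moreover have "min 1 u / 2 \<le> 1 - 1 / (1 + u)"
  proof (cases "u \<le> 1")
    case True
    then have "u * (1 + u) \<le> u * 2" using assms by (intro mult_left_mono) auto
    then show ?thesis using True assms by (simp add: field_simps)
  qed (use assms in \<open>simp add: field_simps\<close>)
  ultimately show ?thesis by linarith
qed

lemma one_minus_exp_le_min:
  fixes u :: real
  shows "1 - exp (- u) \<le> min 1 u"
  using exp_ge_add_one_self[of "- u"] by (simp add: min_def)

lemma bernstein_rep_AE_pos:
  assumes "bernstein_rep \<phi> a b \<mu>"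
  shows "AE t in \<mu>. 0 < t"
proof (rule AE_I')
  show "{..0} \<in> null_sets \<mu>"
    using assms by (auto simp: bernstein_rep_def null_sets_def)
qed auto

lemma bernstein_rep_integrable_min:
  assumes rep: "bernstein_rep \<phi> a b \<mu>" and "0 < q"
  shows "integrable \<mu> (\<lambda>t. min 1 (q * t))"
proof -
  have [measurable_cong]: "sets \<mu> = sets borel"
    using rep by (simp add: bernstein_rep_def)
  note pos = bernstein_rep_AE_pos[OF rep]
  have int1: "integrable \<mu> (\<lambda>t. min 1 t)"
  proof (rule integrableI_bounded)
    have "(\<integral>\<^sup>+t. ennreal (norm (min 1 t)) \<partial>\<mu>) = (\<integral>\<^sup>+t. ennreal (min 1 t) \<partial>\<mu>)"
      by (rule nn_integral_cong_AE) (use pos in eventually_elim, auto)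
    then show "(\<integral>\<^sup>+t. ennreal (norm (min 1 t)) \<partial>\<mu>) < \<infinity>"
      using rep by (simp add: bernstein_rep_def)
  qed measurable
  show ?thesis
  proof (rule Bochner_Integration.integrable_bound)
    show "integrable \<mu> (\<lambda>t. max 1 q * min 1 t)" using int1 by simp
    show "AE t in \<mu>. norm (min 1 (q * t)) \<le> norm (max 1 q * min 1 t)"
      using pos
    proof eventually_elim
      case (elim t)
      have "min 1 (q * t) \<le> max 1 q * min 1 t"
      proof (cases "t \<le> 1")
        case True
        have "q * t \<le> max 1 q * t" using elim by (intro mult_right_mono) auto
        with True show ?thesis by (simp add: min_def)
      next
        case False
        then have "max 1 q * min 1 t = max 1 q" by simp
        moreover have "min 1 (q * t) \<le> 1" "1 \<le> max 1 q" by simp_all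
        ultimately show ?thesis by linarith
      qed
      with elim \<open>0 < q\<close> show ?case by (auto simp: abs_mult)
    qed
  qed measurable
qed

lemma bernstein_rep_integrable:
  assumes rep: "bernstein_rep \<phi> a b \<mu>" and "0 < q"
  shows "integrable \<mu> (\<lambda>t. 1 - exp (- q * t))"
proof (rule Bochner_Integration.integrable_bound)
  have [measurable_cong]: "sets \<mu> = sets borel"
    using rep by (simp add: bernstein_rep_def)
  show "(\<lambda>t. 1 - exp (- q * t)) \<in> borel_measurable \<mu>" by measurable
  show "integrable \<mu> (\<lambda>t. min 1 (q * t))" by (fact bernstein_rep_integrable_min[OF assms])
  show "AE t in \<mu>. norm (1 - exp (- q * t)) \<le> norm (min 1 (q * t))"
    using bernstein_rep_AE_pos[OF rep]
    by eventually_elim (use \<open>0 < q\<close> one_minus_exp_le_min in \<open>auto\<close>)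
qed

lemma bernstein_rep_le_truncated:
  assumes rep: "bernstein_rep \<phi> a b \<mu>" and "0 < r"
  shows "\<phi> r \<le> a + b * r + (\<integral>t. min 1 (r * t) \<partial>\<mu>)"
proof -
  have "(\<integral>t. 1 - exp (- r * t) \<partial>\<mu>) \<le> (\<integral>t. min 1 (r * t) \<partial>\<mu>)"
    using one_minus_exp_le_min[of "r * _"] bernstein_rep_integrable[OF assms] bernstein_rep_integrable_min[OF assms]
    by (intro integral_mono) auto
  then show ?thesis using assms by (simp add: bernstein_rep_def)
qed

lemma truncated_le_bernstein_rep:
  assumes rep: "bernstein_rep \<phi> a b \<mu>" and "0 < r"
  shows "a + b * r + (\<integral>t. min 1 (r * t) \<partial>\<mu>) \<le> 2 * \<phi> r"
proof -
  have "(\<integral>t. min 1 (r * t) \<partial>\<mu>) \<le> (\<integral>t. 2 * (1 - exp (- r * t)) \<partial>\<mu>)"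
  proof (rule integral_mono_AE)
    show "AE t in \<mu>. min 1 (r * t) \<le> 2 * (1 - exp (- r * t))"
      using bernstein_rep_AE_pos[OF rep]
    proof eventually_elim
      case (elim t)
      then show ?case using half_min_le_one_minus_exp[of "r * t"] \<open>0 < r\<close> by simp
    qed
  qed (intro integrable_mult_right bernstein_rep_integrable[OF assms]
      bernstein_rep_integrable_min[OF assms])+
  also have "\<dots> = 2 * (\<integral>t. 1 - exp (- r * t) \<partial>\<mu>)"
    by (rule integral_mult_right_zero)
  finally have "(\<integral>t. min 1 (r * t) \<partial>\<mu>) \<le> 2 * (\<integral>t. 1 - exp (- r * t) \<partial>\<mu>)" .
  moreover have "0 \<le> a" "0 \<le> b * r" "\<phi> r = a + b * r + (\<integral>t. 1 - exp (- r * t) \<partial>\<mu>)"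
    using assms by (simp_all add: bernstein_rep_def)
  ultimately show ?thesis by linarith
qed

lemma bernstein_rep_mono:
  assumes rep: "bernstein_rep \<phi> a b \<mu>" and "0 < r" "r \<le> s"
  shows "\<phi> r \<le> \<phi> s"
proof -
  have "(\<integral>t. 1 - exp (- r * t) \<partial>\<mu>) \<le> (\<integral>t. 1 - exp (- s * t) \<partial>\<mu>)"
  proof (rule integral_mono_AE)
    show "AE t in \<mu>. 1 - exp (- r * t) \<le> 1 - exp (- s * t)"
      using bernstein_rep_AE_pos[OF rep]
      by eventually_elim (use \<open>r \<le> s\<close> in auto)
  qed (use bernstein_rep_integrable[OF rep] assms in auto)
  moreover have "b * r \<le> b * s" using assms by (auto simp: bernstein_rep_def intro: mult_left_mono)
  ultimately show ?thesis using assms by (simp add: bernstein_rep_def)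
qed

text \<open>
  Pointwise, \<open>min 1 (r t)\<close> is at most \<open>\<delta> min 1 (r t / \<delta>) = r t\<close> to the left of \<open>\<delta> / r\<close>, at most
  \<open>min 1 (r t / A) = 1\<close> to the right of \<open>A / r\<close>, and is at most 1 in between.  After integration the
  two tails are values of \<open>\<phi>\<close> at dilated arguments, which regular variation can control; this
  replaces a Tauberian theorem.  The drift term \<open>b r = \<delta> (b r / \<delta>)\<close> joins the left tail and the
  constant \<open>a\<close> joins the right one.
\<close>

lemma bernstein_rep_le_tails_plus_window:
  assumes rep: "bernstein_rep \<phi> a b \<mu>" and r: "0 < r" and \<delta>: "0 < \<delta>" and A: "0 < A"
    and fin: "emeasure \<mu> {\<delta> / r..A / r} < \<infinity>"
  shows "\<phi> r \<le> 2 * \<delta> * \<phi> (r / \<delta>) + 2 * \<phi> (r / A) + measure \<mu> {\<delta> / r..A / r}"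
proof -
  have sets: "sets \<mu> = sets borel" and a: "0 \<le> a" and b: "0 \<le> b"
    using rep by (simp_all add: bernstein_rep_def)
  have pos: "0 < r / \<delta>" "0 < r / A" using assms by auto
  let ?I = "\<lambda>q. (\<integral>t. min 1 (q * t) \<partial>\<mu>)"
  have int: "integrable \<mu> (\<lambda>t. min 1 (q * t))" if "0 < q" for q
    by (rule bernstein_rep_integrable_min[OF rep that])
  have intw: "integrable \<mu> (indicator {\<delta> / r..A / r} :: real \<Rightarrow> real)"
    by (rule integrable_real_indicator) (use fin sets in auto)
  have "?I r \<le> (\<integral>t. \<delta> * min 1 (r / \<delta> * t) + min 1 (r / A * t) + indicator {\<delta> / r..A / r} t \<partial>\<mu>)"
  proof (rule integral_mono_AE)
    show "AE t in \<mu>. min 1 (r * t)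
        \<le> \<delta> * min 1 (r / \<delta> * t) + min 1 (r / A * t) + indicator {\<delta> / r..A / r} t"
      using bernstein_rep_AE_pos[OF rep]
    proof eventually_elim
      case (elim t)
      have nn: "0 \<le> \<delta> * min 1 (r / \<delta> * t)" "0 \<le> min 1 (r / A * t)"
          "0 \<le> (indicator {\<delta> / r..A / r} t :: real)"
        using elim assms by auto
      consider "t < \<delta> / r" | "A / r < t" | "t \<in> {\<delta> / r..A / r}" by fastforce
      then show ?case
      proof cases
        case 1
        then have "r / \<delta> * t \<le> 1" using r \<delta> by (simp add: field_simps)
        then have "\<delta> * min 1 (r / \<delta> * t) = r * t" using \<delta> by (simp add: min_def)
        then have "min 1 (r * t) \<le> \<delta> * min 1 (r / \<delta> * t)" by simp
        then show ?thesis using nn by linarith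
      next
        case 2
        then have "1 \<le> r / A * t" using r A by (simp add: field_simps)
        then have "min 1 (r / A * t) = 1" by simp
        then have "min 1 (r * t) \<le> min 1 (r / A * t)" by simp
        then show ?thesis using nn by linarith
      next
        case 3
        then have "min 1 (r * t) \<le> indicator {\<delta> / r..A / r} t" by simp
        then show ?thesis using nn by linarith
      qed
    qed
  qed (intro Bochner_Integration.integrable_add integrable_mult_right int r pos intw)+
  also have "\<dots> = \<delta> * ?I (r / \<delta>) + ?I (r / A) + measure \<mu> {\<delta> / r..A / r}"
    using int[OF pos(1)] int[OF pos(2)] intw sets
    by (simp add: sets_eq_imp_space_eq[OF sets])
  finally have "?I r \<le> \<delta> * ?I (r / \<delta>) + ?I (r / A) + measure \<mu> {\<delta> / r..A / r}" .
  then have "a + b * r + ?I r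
      \<le> \<delta> * (a + b * (r / \<delta>) + ?I (r / \<delta>)) + (a + b * (r / A) + ?I (r / A)) + measure \<mu> {\<delta> / r..A / r}"
  proof -
    have "0 \<le> \<delta> * a" "0 \<le> b * (r / A)" "\<delta> * (b * (r / \<delta>)) = b * r"
      using a b \<delta> A r by simp_all
    then show ?thesis using \<open>?I r \<le> \<delta> * ?I (r / \<delta>) + ?I (r / A) + measure \<mu> {\<delta> / r..A / r}\<close>
      by (simp only: distrib_left)
  qed
  also have "\<delta> * (a + b * (r / \<delta>) + ?I (r / \<delta>)) \<le> \<delta> * (2 * \<phi> (r / \<delta>))"
    using truncated_le_bernstein_rep[OF rep pos(1)] \<delta> by (intro mult_left_mono) auto
  also have "a + b * (r / A) + ?I (r / A) \<le> 2 * \<phi> (r / A)"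
    by (rule truncated_le_bernstein_rep[OF rep pos(2)])
  finally show ?thesis using bernstein_rep_le_truncated[OF rep r] by simp
qed

section \<open>Measures with a completely monotone density\<close>

lemma completely_monotone_nonneg:
  assumes "completely_monotone m" "0 < t"
  shows "0 \<le> m t"
  using assms unfolding completely_monotone_def by (auto dest: spec[of _ 0])

lemma completely_monotone_decreasing:
  assumes "completely_monotone m" "0 < s" "s \<le> t"
  shows "m t \<le> m s"
proof (rule DERIV_nonpos_imp_nonincreasing[OF \<open>s \<le> t\<close>])
  fix x assume "s \<le> x" "x \<le> t"
  then have "0 < x" using assms by simp
  then have "m field_differentiable at x" "deriv m x \<le> 0"
    using assms(1) unfolding completely_monotone_def
    by (auto dest: spec[of _ 0] spec[of _ 1])
  then show "\<exists>y. (m has_real_derivative y) (at x) \<and> y \<le> 0"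
    using DERIV_deriv_iff_field_differentiable by blast
qed

lemma completely_monotone_measurable:
  assumes "completely_monotone m"
  shows "(\<lambda>t. indicator {0<..} t * m t) \<in> borel_measurable borel"
proof -
  have "m field_differentiable at t" if "0 < t" for t
    using assms that unfolding completely_monotone_def by (auto dest: spec[of _ 0])
  then have "continuous_on {0<..} m"
    by (intro continuous_at_imp_continuous_on ballI field_differentiable_imp_continuous_at) auto
  then have "(\<lambda>t. indicator {0<..} t *\<^sub>R m t) \<in> borel_measurable borel"
    by (intro borel_measurable_continuous_on_indicator) auto
  then show ?thesis by (simp only: real_scaleR_def)
qed

abbreviation half_line_measure :: "(real \<Rightarrow> real) \<Rightarrow> real measure" where
  "half_line_measure m \<equiv> density lborel (\<lambda>t. ennreal (indicator {0<..} t * m t))"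

lemma
  assumes cm: "completely_monotone m" and "0 < s" "s \<le> u"
  shows emeasure_half_line_interval_finite: "emeasure (half_line_measure m) {s..u} < \<infinity>"
    and measure_half_line_interval_le: "measure (half_line_measure m) {s..u} \<le> m s * (u - s)"
    and measure_half_line_interval_ge: "m u * (u - s) \<le> measure (half_line_measure m) {s..u}"
proof -
  let ?E = "emeasure (half_line_measure m) {s..u}"
  have [measurable]: "(\<lambda>t. indicator {0<..} t * m t) \<in> borel_measurable borel"
    by (rule completely_monotone_measurable[OF cm])
  have E: "?E = (\<integral>\<^sup>+t. ennreal (indicator {0<..} t * m t) * indicator {s..u} t \<partial>lborel)"
    by (rule emeasure_density) measurable
  have const: "(\<integral>\<^sup>+t. ennreal k * indicator {s..u} t \<partial>lborel) = ennreal (k * (u - s))" if "0 \<le> k" for k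
    using that \<open>s \<le> u\<close> by (simp add: nn_integral_cmult_indicator ennreal_mult)
  have nn: "0 \<le> m s" "0 \<le> m u" using completely_monotone_nonneg[OF cm] assms by auto
  have "?E \<le> (\<integral>\<^sup>+t. ennreal (m s) * indicator {s..u} t \<partial>lborel)"
    unfolding E using assms completely_monotone_decreasing[OF cm]
    by (intro nn_integral_mono) (auto simp: indicator_def intro!: ennreal_leI)
  then have le: "?E \<le> ennreal (m s * (u - s))" using const nn by simp
  then show fin: "?E < \<infinity>" by (simp add: order_le_less_trans)
  show "measure (half_line_measure m) {s..u} \<le> m s * (u - s)"
    unfolding measure_def using le nn \<open>s \<le> u\<close> by (intro enn2real_leI) auto
  have "(\<integral>\<^sup>+t. ennreal (m u) * indicator {s..u} t \<partial>lborel) \<le> ?E"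
    unfolding E using assms completely_monotone_decreasing[OF cm]
    by (intro nn_integral_mono) (auto simp: indicator_def intro!: ennreal_leI)
  then have "ennreal (m u * (u - s)) \<le> ?E" using const nn by simp
  then show "m u * (u - s) \<le> measure (half_line_measure m) {s..u}"
    unfolding measure_def using fin nn \<open>s \<le> u\<close>
    by (metis diff_ge_0_iff_ge enn2real_ennreal enn2real_mono infinity_ennreal_def mult_nonneg_nonneg)
qed

lemma sbm_levy_density_eq_integral:
  assumes cm: "completely_monotone m"
  shows "sbm_levy_density m x = (\<integral>t. heat_kernel t x \<partial>half_line_measure m)"
proof -
  have [measurable]: "(\<lambda>t. heat_kernel t x) \<in> borel_measurable borel"
    unfolding heat_kernel_def by measurable
  have [measurable]: "(\<lambda>t. indicator {0<..} t * m t) \<in> borel_measurable borel"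
    by (rule completely_monotone_measurable[OF cm])
  have "(\<integral>t. heat_kernel t x \<partial>half_line_measure m)
      = (\<integral>t. (indicator {0<..} t * m t) *\<^sub>R heat_kernel t x \<partial>lborel)"
  proof (rule integral_density)
    show "AE t in lborel. 0 \<le> indicator {0<..} t * m t"
      by (rule AE_I2) (simp add: indicator_def completely_monotone_nonneg[OF cm])
  qed measurable
  then show ?thesis
    unfolding sbm_levy_density_def set_lebesgue_integral_def
    by (simp add: mult_ac)
qed

section \<open>Gaussian bounds\<close>

lemma power_le_exp:
  fixes u :: real
  assumes "0 \<le> u"
  shows "u ^ n \<le> fact n * 4 ^ n * exp (u / 4)"
proof -
  have "(\<Sum>i\<in>{n}. (u / 4) ^ i /\<^sub>R fact i) \<le> exp (u / 4)"
    unfolding exp_def using assms by (intro sum_le_suminf summable_exp_generic) auto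
  then have "(u / 4) ^ n / fact n \<le> exp (u / 4)" by (simp add: field_simps)
  then show ?thesis by (simp add: field_simps)
qed

text \<open>
  With \<open>u = |x|\<^sup>2 / t\<close> the kernel is, up to constants, \<open>|x|\<^sup>-\<^sup>d\<close> times \<open>u powr (d/2) * exp (- u/4)\<close>,
  while \<open>min 1 (|x|\<^sup>-\<^sup>2 t) = min 1 (1/u)\<close>.  For \<open>u \<le> 1\<close> the former is bounded; for \<open>u > 1\<close> the
  exponential absorbs the power and one more factor \<open>u\<close>.  The right-hand side is the integrand
  whose integral against \<open>\<mu>\<close> is comparable to \<open>\<phi>\<close>.
\<close>

lemma heat_kernel_le_truncated:
  "\<exists>C>0. \<forall>t>0. \<forall>x::'a::euclidean_space. x \<noteq> 0 \<longrightarrow>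
     heat_kernel t x \<le> C / norm x ^ DIM('a) * min 1 (norm x powr (-2) * t)"
proof -
  let ?d = "DIM('a)"
  \<comment> \<open>The summand 1 serves \<open>u \<le> 1\<close>; the other one bounds \<open>u ^ (d + 1) * exp (- u / 4)\<close>, and
    \<open>d + 1\<close> is an integer exponent not below \<open>d / 2 + 1\<close>.\<close>
  define C :: real where "C = 1 + fact (?d + 1) * 4 ^ (?d + 1)"
  have "0 < C" unfolding C_def by (simp add: add_pos_nonneg)
  moreover have "heat_kernel t x \<le> C / norm x ^ ?d * min 1 (norm x powr (-2) * t)"
    if t: "0 < t" and x: "x \<noteq> 0" for t and x :: 'a
  proof -
    define u where "u = (norm x)\<^sup>2 / t"
    have u: "0 < u" using t x by (simp add: u_def)
    have inv: "norm x powr (-2) * t = 1 / u"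
      using x t by (simp add: u_def powr_minus powr_realpow field_simps)
    have key: "u powr (?d / 2) \<le> C * exp (u / 4) * min 1 (1 / u)"
    proof (cases "u \<le> 1")
      case True
      have "u powr (?d / 2) \<le> 1" using u True by (intro powr_le1) auto
      moreover have "1 \<le> C" by (simp add: C_def)
      moreover have "1 \<le> exp (u / 4)" using u by simp
      ultimately have "u powr (?d / 2) \<le> C * exp (u / 4)"
        using mult_mono[of 1 C 1 "exp (u/4)"] by simp
      with True u show ?thesis by (simp add: min_def)
    next
      case False
      have "u powr (?d / 2) * u = u powr (?d / 2 + 1)"
        using u by (simp add: powr_add)
      also have "\<dots> \<le> u powr (real (?d + 1))"
        using False by (intro powr_mono) auto
      also have "\<dots> = u ^ (?d + 1)" by (rule powr_realpow[OF u])
      also have "\<dots> \<le> fact (?d + 1) * 4 ^ (?d + 1) * exp (u / 4)"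
        using u by (intro power_le_exp) auto
      also have "\<dots> \<le> C * exp (u / 4)"
        unfolding C_def by (intro mult_right_mono) auto
      finally show ?thesis using False u by (simp add: min_def field_simps)
    qed
    have "(4 * pi * t) powr (- (?d / 2)) \<le> t powr (- (?d / 2))"
      using t pi_gt3 by (intro powr_mono2') auto
    also have "t powr (- (?d / 2)) = u powr (?d / 2) / norm x ^ ?d"
    proof -
      have "((norm x)\<^sup>2) powr (?d / 2) = norm x ^ ?d"
        using x by (simp add: powr_powr powr_realpow flip: powr_numeral)
      then show ?thesis
        using x t unfolding u_def by (simp add: powr_divide powr_minus field_simps)
    qed
    finally have "heat_kernel t x \<le> u powr (?d / 2) / norm x ^ ?d * exp (- u / 4)"
      unfolding heat_kernel_def u_def by (intro mult_mono) (auto simp: field_simps)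
    also have "\<dots> \<le> C * exp (u / 4) * min 1 (1 / u) / norm x ^ ?d * exp (- u / 4)"
      using key by (intro mult_right_mono divide_right_mono) auto
    also have "\<dots> = C / norm x ^ ?d * min 1 (1 / u) * (exp (u / 4) * exp (- u / 4))" by simp
    also have "exp (u / 4) * exp (- u / 4) = 1" by (simp flip: exp_add)
    finally show ?thesis by (simp add: inv)
  qed
  ultimately show ?thesis by blast
qed

lemma heat_kernel_ge:
  fixes x :: "'a::euclidean_space"
  assumes "0 < s" "t \<in> {s / 2..s}"
  shows "(4 * pi * s) powr (- (real DIM('a) / 2)) * exp (- (norm x)\<^sup>2 / (2 * s)) \<le> heat_kernel t x"
  unfolding heat_kernel_def
proof (intro mult_mono)
  have t: "0 < t" using assms by auto
  show "(4 * pi * s) powr (- (real DIM('a) / 2)) \<le> (4 * pi * t) powr (- (real DIM('a) / 2))"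
    using assms t by (intro powr_mono2') auto
  have "(norm x)\<^sup>2 / (4 * t) \<le> (norm x)\<^sup>2 / (2 * s)"
    using assms t by (intro divide_left_mono) auto
  then show "exp (- (norm x)\<^sup>2 / (2 * s)) \<le> exp (- (norm x)\<^sup>2 / (4 * t))" by simp
qed auto

lemma heat_kernel_nonneg: "0 \<le> heat_kernel t x"
  by (simp add: heat_kernel_def)

section \<open>Bounds for the jump density\<close>

lemma
  assumes cbr: "complete_bernstein_rep \<phi> a b m"
  shows integrable_heat_kernel: "\<And>x::'a::euclidean_space. x \<noteq> 0 \<Longrightarrow>
          integrable (half_line_measure m) (\<lambda>t. heat_kernel t x)"
    and sbm_levy_density_upper: "\<exists>C>0. \<forall>x::'a. x \<noteq> 0 \<longrightarrow>
          sbm_levy_density m x \<le> C * (\<phi> (norm x powr (-2)) / norm x ^ DIM('a))"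
proof -
  let ?\<mu> = "half_line_measure m"
  have cm: "completely_monotone m" and rep: "bernstein_rep \<phi> a b ?\<mu>"
    using cbr by (simp_all add: complete_bernstein_rep_def)
  obtain C where C: "0 < C" and le: "\<And>t x::'a. 0 < t \<Longrightarrow> x \<noteq> 0 \<Longrightarrow>
      heat_kernel t x \<le> C / norm x ^ DIM('a) * min 1 (norm x powr (-2) * t)"
    using heat_kernel_le_truncated[where 'a = 'a] by blast
  have AEle: "AE t in ?\<mu>. heat_kernel t x \<le> C / norm x ^ DIM('a) * min 1 (norm x powr (-2) * t)"
    if "x \<noteq> 0" for x :: 'a
    using bernstein_rep_AE_pos[OF rep] by eventually_elim (use le that in auto)
  have intm: "integrable ?\<mu> (\<lambda>t. C / norm x ^ DIM('a) * min 1 (norm x powr (-2) * t))"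
    if "x \<noteq> 0" for x :: 'a
    using bernstein_rep_integrable_min[OF rep, of "norm x powr (-2)"] that by simp
  show int: "integrable ?\<mu> (\<lambda>t. heat_kernel t x)" if "x \<noteq> 0" for x :: 'a
  proof (rule Bochner_Integration.integrable_bound[OF intm[OF that]])
    have "(\<lambda>t. heat_kernel t x) \<in> borel_measurable borel"
      unfolding heat_kernel_def by measurable
    then show "(\<lambda>t. heat_kernel t x) \<in> borel_measurable ?\<mu>" by simp
    show "AE t in ?\<mu>. norm (heat_kernel t x)
        \<le> norm (C / norm x ^ DIM('a) * min 1 (norm x powr (-2) * t))"
      using AEle[OF that]
    proof eventually_elim
      case (elim t)
      have "norm (heat_kernel t x) = heat_kernel t x" by (simp add: heat_kernel_nonneg)
      also note elim
      also note abs_ge_self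
      finally show ?case by (simp only: real_norm_def)
    qed
  qed
  have "sbm_levy_density m x \<le> 2 * C * (\<phi> (norm x powr (-2)) / norm x ^ DIM('a))"
    if "x \<noteq> 0" for x :: 'a
  proof -
    let ?R = "norm x powr (-2)"
    have R: "0 < ?R" using that by simp
    have "sbm_levy_density m x \<le> (\<integral>t. C / norm x ^ DIM('a) * min 1 (?R * t) \<partial>?\<mu>)"
      unfolding sbm_levy_density_eq_integral[OF cm]
      by (rule integral_mono_AE[OF int[OF that] intm[OF that] AEle[OF that]])
    also have "\<dots> = C / norm x ^ DIM('a) * (\<integral>t. min 1 (?R * t) \<partial>?\<mu>)" by simp
    also have "\<dots> \<le> C / norm x ^ DIM('a) * (2 * \<phi> ?R)"
    proof (rule mult_left_mono)
      have "0 \<le> a" "0 \<le> b * ?R" using rep R by (auto simp: bernstein_rep_def)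
      then show "(\<integral>t. min 1 (?R * t) \<partial>?\<mu>) \<le> 2 * \<phi> ?R"
        using truncated_le_bernstein_rep[OF rep R] by linarith
    qed (use C in auto)
    finally show ?thesis by (simp add: mult_ac)
  qed
  then show "\<exists>C>0. \<forall>x::'a. x \<noteq> 0 \<longrightarrow>
          sbm_levy_density m x \<le> C * (\<phi> (norm x powr (-2)) / norm x ^ DIM('a))"
    using C by (intro exI[of _ "2 * C"]) auto
qed

lemma sbm_levy_density_ge_window:
  fixes x :: "'a::euclidean_space"
  assumes cbr: "complete_bernstein_rep \<phi> a b m" and "x \<noteq> 0" "0 < s"
  shows "(4 * pi * s) powr (- (real DIM('a) / 2)) * exp (- (norm x)\<^sup>2 / (2 * s)) * (m s * (s / 2))
    \<le> sbm_levy_density m x"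
proof -
  let ?\<mu> = "half_line_measure m"
  let ?k = "(4 * pi * s) powr (- (real DIM('a) / 2)) * exp (- (norm x)\<^sup>2 / (2 * s))"
  have cm: "completely_monotone m"
    using cbr by (simp add: complete_bernstein_rep_def)
  have fin: "emeasure ?\<mu> {s / 2..s} < \<infinity>"
    using emeasure_half_line_interval_finite[OF cm] assms by simp
  have "m s * (s / 2) \<le> measure ?\<mu> {s / 2..s}"
    using measure_half_line_interval_ge[OF cm, of "s / 2" s] assms by simp
  then have "?k * (m s * (s / 2)) \<le> ?k * measure ?\<mu> {s / 2..s}"
    by (intro mult_left_mono) auto
  also have "\<dots> = (\<integral>t. ?k * indicator {s / 2..s} t \<partial>?\<mu>)" by simp
  also have "\<dots> \<le> (\<integral>t. heat_kernel t x \<partial>?\<mu>)"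
  proof (rule integral_mono)
    show "integrable ?\<mu> (\<lambda>t. ?k * indicator {s / 2..s} t)"
      using fin by (intro integrable_mult_right integrable_real_indicator) auto
    show "?k * indicator {s / 2..s} t \<le> heat_kernel t x" for t
      using heat_kernel_ge[OF \<open>0 < s\<close>, of t x] heat_kernel_nonneg[of t x]
      by (simp add: indicator_def)
  qed (rule integrable_heat_kernel[OF cbr \<open>x \<noteq> 0\<close>])
  finally show ?thesis by (simp add: sbm_levy_density_eq_integral[OF cm])
qed

section \<open>Regular variation and the lower bound\<close>

text \<open>
  The constant \<open>C\<close> must not depend on the dilation \<open>c\<close>: only then can \<open>c\<close> be chosen later so
  that \<open>C * c powr \<beta>\<close> is small compared with a given number.  Slow variation provides this because
  \<open>l (c r) / l r\<close> drops below 2 for every fixed \<open>c\<close>; just the threshold for \<open>r\<close> depends on \<open>c\<close>.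
\<close>

lemma regularly_varying_dilation_le:
  assumes cmp: "comparable_on {1..} \<phi> (\<lambda>r. r powr \<beta> * l r)"
    and l: "\<forall>t>0. 0 < l t" and sv: "slowly_varying l"
  shows "\<exists>C>0. \<forall>c>0. \<forall>\<^sub>F r in at_top. \<phi> (c * r) \<le> C * c powr \<beta> * \<phi> r"
proof -
  obtain k where k: "1 < k" and bd: "\<And>r. 1 \<le> r \<Longrightarrow> inverse k \<le> \<phi> r / (r powr \<beta> * l r)"
    "\<And>r. 1 \<le> r \<Longrightarrow> \<phi> r / (r powr \<beta> * l r) \<le> k"
    using cmp unfolding comparable_on_def by auto
  have "\<forall>\<^sub>F r in at_top. \<phi> (c * r) \<le> 2 * k\<^sup>2 * c powr \<beta> * \<phi> r" if c: "0 < c" for c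
  proof -
    have "((\<lambda>t. l (c * t) / l t) \<longlongrightarrow> 1) at_top" using sv c by (simp add: slowly_varying_def)
    then have "\<forall>\<^sub>F r in at_top. l (c * r) / l r < 2" by (rule order_tendstoD) simp
    moreover have "\<forall>\<^sub>F r in at_top. max 1 (1 / c) \<le> r" by (rule eventually_ge_at_top)
    ultimately show ?thesis
    proof eventually_elim
      case (elim r)
      then have r: "1 \<le> r" "1 \<le> c * r" using c by (auto simp: field_simps)
      have lp: "0 < l r" using l r by simp
      have lp': "0 < l (c * r)" using l r by simp
      have "\<phi> (c * r) \<le> k * ((c * r) powr \<beta> * l (c * r))"
        using bd(2)[OF r(2)] lp' r c by (simp add: pos_divide_le_eq)
      also have "\<dots> \<le> k * ((c * r) powr \<beta> * (2 * l r))"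
        using elim(1) lp k by (intro mult_left_mono) (auto simp: field_simps)
      also have "\<dots> = 2 * k * c powr \<beta> * (r powr \<beta> * l r)"
        using c r by (simp add: powr_mult)
      also have "\<dots> \<le> 2 * k * c powr \<beta> * (k * \<phi> r)"
      proof (rule mult_left_mono)
        show "r powr \<beta> * l r \<le> k * \<phi> r"
          using bd(1)[OF r(1)] lp r k by (simp add: field_simps)
      qed (use k in auto)
      finally show ?case by (simp add: power2_eq_square mult_ac)
    qed
  qed
  then show ?thesis using k by (intro exI[of _ "2 * k\<^sup>2"]) auto
qed

lemma exists_scale_powr_le:
  fixes \<epsilon> \<gamma> :: real
  assumes "0 < \<epsilon>" "0 < \<gamma>"
  obtains \<delta> where "0 < \<delta>" "\<delta> \<le> 1" "\<delta> powr \<gamma> \<le> \<epsilon>"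
proof
  let ?\<delta> = "min 1 \<epsilon> powr (1 / \<gamma>)"
  show "0 < ?\<delta>" using assms by simp
  show "?\<delta> \<le> 1" using assms by (intro powr_le1) auto
  show "?\<delta> powr \<gamma> \<le> \<epsilon>" using assms by (simp add: powr_powr)
qed

text \<open>
  In the splitting inequality with \<open>A = 1 / \<eta>\<close> both tails become at most \<open>\<phi>(r) / 4\<close>: the left one is
  a multiple of \<open>\<delta> powr (1 - \<beta>)\<close>, small because \<open>\<beta> < 1\<close>, and the right one a multiple of
  \<open>\<eta> powr \<beta>\<close>, small because \<open>\<beta> > 0\<close>.  Hence the window has mass at least \<open>\<phi>(r) / 2\<close>, and
  monotonicity of \<open>m\<close> concentrates this information at the left end point \<open>s = \<delta> / r\<close>.
\<close>

lemma complete_bernstein_density_lower: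
  assumes cbr: "complete_bernstein_rep \<phi> a b m" and \<beta>: "0 < \<beta>" "\<beta> < 1"
    and C: "0 < C" and dil: "\<And>c. 0 < c \<Longrightarrow> \<forall>\<^sub>F r in at_top. \<phi> (c * r) \<le> C * c powr \<beta> * \<phi> r"
    and pos: "\<And>r. 1 \<le> r \<Longrightarrow> 0 < \<phi> r"
  shows "\<exists>k>0. \<exists>t\<^sub>1>0. t\<^sub>1 \<le> 1 \<and> (\<forall>s. 0 < s \<and> s \<le> t\<^sub>1 \<longrightarrow> k * \<phi> (1 / s) \<le> m s * s)"
proof -
  have cm: "completely_monotone m" and rep: "bernstein_rep \<phi> a b (half_line_measure m)"
    using cbr by (simp_all add: complete_bernstein_rep_def)
  obtain \<delta> where \<delta>: "0 < \<delta>" "\<delta> \<le> 1" "\<delta> powr (1 - \<beta>) \<le> 1 / (8 * C)"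
    using exists_scale_powr_le[of "1 / (8 * C)" "1 - \<beta>"] C \<beta> by auto
  obtain \<eta> where \<eta>: "0 < \<eta>" "\<eta> \<le> 1" "\<eta> powr \<beta> \<le> 1 / (8 * C)"
    using exists_scale_powr_le[of "1 / (8 * C)" "\<beta>"] C \<beta> by auto
  have "\<forall>\<^sub>F r in at_top. 1 \<le> r \<and> \<phi> (1 / \<delta> * r) \<le> C * (1 / \<delta>) powr \<beta> * \<phi> r
      \<and> \<phi> (\<eta> * r) \<le> C * \<eta> powr \<beta> * \<phi> r"
    using dil[of "1 / \<delta>"] dil[of \<eta>] \<delta> \<eta> eventually_ge_at_top[of 1]
    by (auto simp: eventually_conj_iff)
  then obtain r\<^sub>0 where r0: "\<And>r. r\<^sub>0 \<le> r \<Longrightarrow> 1 \<le> r \<and> \<phi> (1 / \<delta> * r) \<le> C * (1 / \<delta>) powr \<beta> * \<phi> r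
      \<and> \<phi> (\<eta> * r) \<le> C * \<eta> powr \<beta> * \<phi> r"
    unfolding eventually_at_top_linorder by blast
  \<comment> \<open>The window gives \<open>\<delta> * \<eta> / 2 * \<phi> (\<delta> / s) \<le> m s * s\<close>; the remaining factor of \<open>k\<close> pays for
    replacing \<open>\<phi> (\<delta> / s)\<close> by \<open>\<phi> (1 / s)\<close>.\<close>
  define k where "k = \<delta> * \<eta> / (2 * (C * (1 / \<delta>) powr \<beta>))"
  define t\<^sub>1 where "t\<^sub>1 = min 1 (\<delta> / max 1 r\<^sub>0)"
  have "0 < k" using \<delta> \<eta> C by (simp add: k_def)
  moreover have "0 < t\<^sub>1" "t\<^sub>1 \<le> 1" using \<delta> by (auto simp: t\<^sub>1_def)
  moreover have "k * \<phi> (1 / s) \<le> m s * s" if s: "0 < s" "s \<le> t\<^sub>1" for s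
  proof -
    define r where "r = \<delta> / s"
    have r: "r\<^sub>0 \<le> r" "1 \<le> r"
    proof -
      have "s \<le> \<delta> / max 1 r\<^sub>0" using s by (simp add: t\<^sub>1_def)
      then have "max 1 r\<^sub>0 \<le> r" using s by (simp add: r_def field_simps max_def split: if_splits)
      then show "r\<^sub>0 \<le> r" "1 \<le> r" by auto
    qed
    have \<phi>r: "0 < \<phi> r" using pos r by simp
    have s': "\<delta> / r = s" "1 / s = 1 / \<delta> * r" using s \<delta> by (auto simp: r_def)
    have le: "\<delta> / r \<le> (1 / \<eta>) / r"
      using \<delta> \<eta> r by (intro divide_right_mono) (auto simp: field_simps intro: mult_le_one)
    have sp: "0 < \<delta> / r" using s s' by simp
    have "\<phi> r \<le> 2 * \<delta> * \<phi> (r / \<delta>) + 2 * \<phi> (r / (1 / \<eta>)) + measure (half_line_measure m) {\<delta> / r..(1 / \<eta>) / r}"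
      by (rule bernstein_rep_le_tails_plus_window[OF rep])
        (use emeasure_half_line_interval_finite[OF cm sp le] r \<delta> \<eta> in auto)
    also have "measure (half_line_measure m) {\<delta> / r..(1 / \<eta>) / r} \<le> m s * ((1 / \<eta>) / r)"
    proof -
      have "0 \<le> m s" using completely_monotone_nonneg[OF cm] s by simp
      then have "m s * ((1 / \<eta>) / r - s) \<le> m s * ((1 / \<eta>) / r)"
        using s by (intro mult_left_mono) auto
      then show ?thesis using measure_half_line_interval_le[OF cm sp le] s' by simp
    qed
    also have "2 * \<delta> * \<phi> (r / \<delta>) \<le> \<phi> r / 4"
    proof -
      have "2 * \<delta> * \<phi> (r / \<delta>) \<le> 2 * \<delta> * (C * (1 / \<delta>) powr \<beta> * \<phi> r)"
        using r0[OF r(1)] \<delta> by (intro mult_left_mono) auto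
      also have "\<dots> = 2 * C * \<phi> r * (\<delta> powr (1 - \<beta>))"
        using \<delta> by (simp add: powr_diff powr_divide)
      also have "\<dots> \<le> 2 * C * \<phi> r * (1 / (8 * C))"
        using \<delta> C \<phi>r by (intro mult_left_mono) auto
      finally show ?thesis using C by simp
    qed
    also have "2 * \<phi> (r / (1 / \<eta>)) \<le> \<phi> r / 4"
    proof -
      have "2 * \<phi> (r / (1 / \<eta>)) \<le> 2 * C * \<phi> r * \<eta> powr \<beta>"
        using r0[OF r(1)] by (simp add: mult_ac)
      also have "\<dots> \<le> 2 * C * \<phi> r * (1 / (8 * C))"
        using \<eta> C \<phi>r by (intro mult_left_mono) auto
      finally show ?thesis using C by simp
    qed
    finally have "\<phi> r / 2 \<le> m s * ((1 / \<eta>) / r)" by linarith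
    then have half: "\<delta> * \<eta> / 2 * \<phi> r \<le> m s * s"
      using \<delta> \<eta> s by (simp add: r_def field_simps)
    have "k * \<phi> (1 / s) \<le> k * (C * (1 / \<delta>) powr \<beta> * \<phi> r)"
      unfolding s' using r0[OF r(1)] \<open>0 < k\<close> by (intro mult_left_mono) auto
    also have "\<dots> = \<delta> * \<eta> / 2 * \<phi> r" using C \<delta> by (simp add: k_def)
    finally show ?thesis using half by simp
  qed
  ultimately show ?thesis by blast
qed

text \<open>
  With \<open>s = t\<^sub>1 |x|\<^sup>2\<close> the Gaussian exponent on \<open>[s/2, s]\<close> does not depend on \<open>x\<close>, the
  threshold \<open>s \<le> t\<^sub>1\<close> is met for all \<open>|x| \<le> 1\<close>, and \<open>1 / s \<ge> |x|\<^sup>-\<^sup>2\<close>, so that \<open>\<phi> (1 / s)\<close>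
  dominates \<open>\<phi> (|x|\<^sup>-\<^sup>2)\<close> by monotonicity.
\<close>

lemma sbm_levy_density_lower:
  assumes cbr: "complete_bernstein_rep \<phi> a b m"
    and k: "0 < k" and t1: "0 < t\<^sub>1" "t\<^sub>1 \<le> 1"
    and low: "\<And>s. 0 < s \<Longrightarrow> s \<le> t\<^sub>1 \<Longrightarrow> k * \<phi> (1 / s) \<le> m s * s"
  shows "\<exists>C>0. \<forall>x::'a::euclidean_space. 0 < norm x \<and> norm x \<le> 1 \<longrightarrow>
    C * (\<phi> (norm x powr (-2)) / norm x ^ DIM('a)) \<le> sbm_levy_density m x"
proof -
  let ?d = "real DIM('a) / 2"
  have cm: "completely_monotone m" and rep: "bernstein_rep \<phi> a b (half_line_measure m)"
    using cbr by (simp_all add: complete_bernstein_rep_def)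
  define C where "C = (4 * pi * t\<^sub>1) powr (- ?d) * exp (- 1 / (2 * t\<^sub>1)) * (k / 2)"
  have "C * (\<phi> (norm x powr (-2)) / norm x ^ DIM('a)) \<le> sbm_levy_density m x"
    if x: "0 < norm x" "norm x \<le> 1" for x :: 'a
  proof -
    define s where "s = t\<^sub>1 * (norm x)\<^sup>2"
    have s: "0 < s" using t1 x by (simp add: s_def)
    have "(norm x)\<^sup>2 \<le> 1" using x by (simp add: power_le_one)
    then have s1: "s \<le> t\<^sub>1" using t1 mult_left_mono[of "(norm x)\<^sup>2" 1 "t\<^sub>1"] by (simp add: s_def)
    have R: "norm x powr (-2) = 1 / (norm x)\<^sup>2"
      using x by (simp add: powr_minus powr_realpow field_simps)
    have "norm x powr (-2) \<le> 1 / s"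
      unfolding R s_def using t1 x
      by (intro divide_left_mono) (auto simp: mult_le_cancel_right1)
    then have "\<phi> (norm x powr (-2)) \<le> \<phi> (1 / s)"
      using x by (intro bernstein_rep_mono[OF rep]) auto
    then have "k * \<phi> (norm x powr (-2)) \<le> k * \<phi> (1 / s)" using k by simp
    also have "\<dots> \<le> m s * s" by (rule low[OF s s1])
    finally have ms: "k / 2 * \<phi> (norm x powr (-2)) \<le> m s * (s / 2)" by simp
    have e: "- (norm x)\<^sup>2 / (2 * s) = - 1 / (2 * t\<^sub>1)"
      using x t1 by (simp add: s_def)
    have p: "(4 * pi * s) powr (- ?d) = (4 * pi * t\<^sub>1) powr (- ?d) / norm x ^ DIM('a)"
    proof -
      have "((norm x)\<^sup>2) powr ?d = norm x ^ DIM('a)"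
        using x by (simp add: powr_powr powr_realpow flip: powr_numeral)
      moreover have "(4 * pi * s) powr (- ?d) = (4 * pi * t\<^sub>1) powr (- ?d) * ((norm x)\<^sup>2) powr (- ?d)"
        using t1 by (simp add: s_def powr_mult flip: mult.assoc)
      ultimately show ?thesis by (simp add: powr_minus field_simps)
    qed
    have "C * (\<phi> (norm x powr (-2)) / norm x ^ DIM('a))
        = (4 * pi * s) powr (- ?d) * exp (- (norm x)\<^sup>2 / (2 * s)) * (k / 2 * \<phi> (norm x powr (-2)))"
      unfolding C_def p e by simp
    also have "\<dots> \<le> (4 * pi * s) powr (- ?d) * exp (- (norm x)\<^sup>2 / (2 * s)) * (m s * (s / 2))"
      using ms by (intro mult_left_mono) auto
    also have "\<dots> \<le> sbm_levy_density m x"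
      using x by (intro sbm_levy_density_ge_window[OF cbr _ s]) auto
    finally show ?thesis .
  qed
  moreover have "0 < C" using t1 k by (simp add: C_def)
  ultimately show ?thesis by blast
qed

section \<open>Two-sided comparison\<close>

lemma comparable_onI:
  assumes "0 < c" "0 < C" "\<And>x. x \<in> A \<Longrightarrow> 0 < g x"
    and "\<And>x. x \<in> A \<Longrightarrow> c * g x \<le> f x" "\<And>x. x \<in> A \<Longrightarrow> f x \<le> C * g x"
  shows "comparable_on A f g"
  unfolding comparable_on_def
proof (intro exI conjI ballI)
  let ?k = "max 2 (max C (inverse c))"
  show "1 < ?k" by simp
  fix x assume x: "x \<in> A"
  have "inverse ?k \<le> inverse (inverse c)"
    using assms(1) by (intro le_imp_inverse_le) auto
  also have "\<dots> \<le> f x / g x" using assms(3,4)[OF x] by (simp add: field_simps)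
  finally show "inverse ?k \<le> f x / g x" .
  have "f x / g x \<le> C" using assms(3,5)[OF x] by (simp add: field_simps)
  then show "f x / g x \<le> ?k" by simp
qed

theorem theorem3p4:
  fixes M :: "'w measure"
    and B X :: "real \<Rightarrow> 'w \<Rightarrow> 'a::euclidean_space"
    and S :: "real \<Rightarrow> 'w \<Rightarrow> real"
    and \<phi> m l :: "real \<Rightarrow> real"
    and b \<alpha> :: real
    and J :: "'a \<Rightarrow> real"
  assumes "subordinate_brownian_motion M B S X"
    and "laplace_exponent M S \<phi>"
    and "complete_bernstein_rep \<phi> 0 b m"
    and "0 < \<alpha>" and "\<alpha> < 2"
    and "set_borel_measurable borel {0<..} l"
    and "\<forall>t>0. 0 < l t"
    and "locally_bounded_above_below l"
    and "slowly_varying l"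
    and "comparable_on {1..} \<phi> (\<lambda>r. r powr (\<alpha> / 2) * l r)"
    and "J = sbm_levy_density m"
  shows "comparable_on {x. 0 < norm x \<and> norm x \<le> 1}
           J (\<lambda>x. \<phi> (norm x powr (-2)) / norm x ^ DIM('a))
       \<and> comparable_on {x :: 'a. 0 < norm x \<and> norm x \<le> 1}
           (\<lambda>x. \<phi> (norm x powr (-2)) / norm x ^ DIM('a))
           (\<lambda>x. l (norm x powr (-2)) / norm x powr (real DIM('a) + \<alpha>))"
proof
  note cbr = \<open>complete_bernstein_rep \<phi> 0 b m\<close>
  have l: "0 < l t" if "0 < t" for t using assms(7) that by blast
  obtain c where c: "1 < c" and cmp: "\<And>r. 1 \<le> r \<Longrightarrow> inverse c \<le> \<phi> r / (r powr (\<alpha> / 2) * l r)"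
      "\<And>r. 1 \<le> r \<Longrightarrow> \<phi> r / (r powr (\<alpha> / 2) * l r) \<le> c"
    using \<open>comparable_on {1..} \<phi> _\<close> unfolding comparable_on_def by auto
  have pos: "0 < \<phi> r" if "1 \<le> r" for r
  proof -
    have "0 < \<phi> r / (r powr (\<alpha> / 2) * l r)"
      using cmp(1)[OF that] c by (meson less_le_trans inverse_positive_iff_positive less_trans zero_less_one)
    moreover have "0 < r powr (\<alpha> / 2) * l r" using l[of r] that by simp
    ultimately show ?thesis using pos_less_divide_eq by fastforce
  qed
  have R: "1 \<le> norm x powr (-2)" if "0 < norm x" "norm x \<le> 1" for x :: 'a
    using that by (simp add: powr_minus powr_realpow field_simps power_le_one)
  obtain D where D: "0 < D" "\<And>c. 0 < c \<Longrightarrow> \<forall>\<^sub>F r in at_top. \<phi> (c * r) \<le> D * c powr (\<alpha> / 2) * \<phi> r"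
    using regularly_varying_dilation_le[OF \<open>comparable_on {1..} \<phi> _\<close> assms(7,9)] by blast
  obtain k t\<^sub>1 where "0 < k" "0 < t\<^sub>1" "t\<^sub>1 \<le> 1"
      "\<And>s. 0 < s \<Longrightarrow> s \<le> t\<^sub>1 \<Longrightarrow> k * \<phi> (1 / s) \<le> m s * s"
    using complete_bernstein_density_lower[OF cbr _ _ D pos] assms(4,5) by auto
  from sbm_levy_density_lower[OF cbr this, where 'a = 'a]
  obtain c1 where c1: "0 < c1" "\<And>x::'a. 0 < norm x \<Longrightarrow> norm x \<le> 1 \<Longrightarrow>
      c1 * (\<phi> (norm x powr (-2)) / norm x ^ DIM('a)) \<le> sbm_levy_density m x"
    by blast
  obtain c2 where c2: "0 < c2" "\<And>x::'a. x \<noteq> 0 \<Longrightarrow>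
      sbm_levy_density m x \<le> c2 * (\<phi> (norm x powr (-2)) / norm x ^ DIM('a))"
    using sbm_levy_density_upper[OF cbr, where 'a = 'a] by blast
  show "comparable_on {x. 0 < norm x \<and> norm x \<le> 1}
           J (\<lambda>x. \<phi> (norm x powr (-2)) / norm x ^ DIM('a))"
    unfolding \<open>J = _\<close> using c1 c2 pos[OF R]
    by (intro comparable_onI[of c1 c2]) auto
  show "comparable_on {x :: 'a. 0 < norm x \<and> norm x \<le> 1}
           (\<lambda>x. \<phi> (norm x powr (-2)) / norm x ^ DIM('a))
           (\<lambda>x. l (norm x powr (-2)) / norm x powr (real DIM('a) + \<alpha>))"
    unfolding comparable_on_def
  proof (intro exI[of _ c] conjI ballI)
    fix x :: 'a assume "x \<in> {x. 0 < norm x \<and> norm x \<le> 1}"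
    then have x: "0 < norm x" "norm x \<le> 1" by auto
    let ?R = "norm x powr (-2)"
    have "?R powr (\<alpha> / 2) = 1 / norm x powr \<alpha>"
      unfolding powr_powr by (simp add: powr_minus_divide)
    then have "\<phi> ?R / norm x ^ DIM('a) / (l ?R / norm x powr (real DIM('a) + \<alpha>))
        = \<phi> ?R / (?R powr (\<alpha> / 2) * l ?R)"
      using x by (simp add: powr_add powr_realpow)
    then show "inverse c \<le> \<phi> ?R / norm x ^ DIM('a) / (l ?R / norm x powr (real DIM('a) + \<alpha>))"
        "\<phi> ?R / norm x ^ DIM('a) / (l ?R / norm x powr (real DIM('a) + \<alpha>)) \<le> c"
      using cmp[OF R[OF x]] by simp_all
  qed (fact c)
qed

end
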